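(* For every fixed integer $k\ge 3$, as $n\to\infty$, \[ f(n,k)=(1+o(1))\left(\frac{n}{k-1}\right)^{k-1}. \]
   Context: An antichain in $2^{[n]}$ (where $[n]=\{1,\dots,n\}$) is a family of subsets of $[n]$ none of which is contained in another. There is an unknown antichain $\mathcal{S}\subseteq 2^{[n]}$ with exactly $k$ members. A query is a set $Q\subseteq[n]$, answered YES if $Q\supseteq S$ for some $S\in\mathcal{S}$ and NO otherwise. $f(n,k)$ is the smallest $q$ such that some adaptive strategy (queries may depend on previous answers) determines every $k$-member antichain $\mathcal{S}$ uniquely using at most $q$ queries in the worst case. *)

theory Defs
  imports Complex_Main "HOL-Library.Landau_Symbols"
begin

definition antichains :: "nat \<Rightarrow> nat \<Rightarrow> nat set set set" where
  "antichains n k =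
    {\<S>. \<S> \<subseteq> Pow {1..n} \<and> card \<S> = k \<and> (\<forall>A\<in>\<S>. \<forall>B\<in>\<S>. A \<noteq> B \<longrightarrow> \<not> A \<subseteq> B)}"

definition answer :: "nat set set \<Rightarrow> nat set \<Rightarrow> bool" where
  "answer \<S> Q \<longleftrightarrow> (\<exists>S\<in>\<S>. S \<subseteq> Q)"

text \<open>
  An adaptive strategy is a binary decision tree: \<open>Ask Q t u\<close> poses the query \<open>Q\<close> and continues
  with \<open>t\<close> on the answer YES and with \<open>u\<close> on the answer NO; a leaf announces a family.
\<close>

datatype strategy = Announce "nat set set" | Ask "nat set" strategy strategy

primrec valid_strategy :: "nat \<Rightarrow> strategy \<Rightarrow> bool" where
  "valid_strategy n (Announce \<F>) \<longleftrightarrow> True"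
| "valid_strategy n (Ask Q t u) \<longleftrightarrow> Q \<subseteq> {1..n} \<and> valid_strategy n t \<and> valid_strategy n u"

primrec announced :: "nat set set \<Rightarrow> strategy \<Rightarrow> nat set set" where
  "announced \<S> (Announce \<F>) = \<F>"
| "announced \<S> (Ask Q t u) = (if answer \<S> Q then announced \<S> t else announced \<S> u)"

primrec queries_used :: "nat set set \<Rightarrow> strategy \<Rightarrow> nat" where
  "queries_used \<S> (Announce \<F>) = 0"
| "queries_used \<S> (Ask Q t u) = Suc (if answer \<S> Q then queries_used \<S> t else queries_used \<S> u)"

definition identifies_within :: "nat \<Rightarrow> nat \<Rightarrow> nat \<Rightarrow> strategy \<Rightarrow> bool" where
  "identifies_within n k q t \<longleftrightarrow>
    valid_strategy n t \<and> (\<forall>\<S>\<in>antichains n k. announced \<S> t = \<S> \<and> queries_used \<S> t \<le> q)"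

definition query_complexity :: "nat \<Rightarrow> nat \<Rightarrow> nat" where
  "query_complexity n k = (LEAST q. \<exists>t. identifies_within n k q t)"

text \<open>The least number exists: asking all subsets of \<open>{1..n}\<close> identifies every antichain.\<close>

lemma antichain_eq_if_same_answers:
  assumes S: "\<S> \<in> antichains n k" and T: "\<T> \<in> antichains n k"
    and eq: "\<And>Q. Q \<subseteq> {1..n} \<Longrightarrow> answer \<S> Q = answer \<T> Q"
  shows "\<S> = \<T>"
proof -
  have "\<U> \<subseteq> \<V>" if U: "\<U> \<in> antichains n k" and V: "\<V> \<in> antichains n k"
    and e: "\<And>Q. Q \<subseteq> {1..n} \<Longrightarrow> answer \<U> Q = answer \<V> Q" for \<U> \<V>
  proof
    fix A assume A: "A \<in> \<U>"
    then have "A \<subseteq> {1..n}" using U by (auto simp: antichains_def)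
    moreover have "answer \<U> A" using A by (auto simp: answer_def)
    ultimately have "answer \<V> A" using e by simp
    then obtain B where B: "B \<in> \<V>" "B \<subseteq> A" by (auto simp: answer_def)
    then have "B \<subseteq> {1..n}" using V by (auto simp: antichains_def)
    moreover have "answer \<V> B" using B by (auto simp: answer_def)
    ultimately have "answer \<U> B" using e by simp
    then obtain C where C: "C \<in> \<U>" "C \<subseteq> B" by (auto simp: answer_def)
    have "C \<subseteq> A" using B(2) C(2) by blast
    then have "C = A" using A C(1) U unfolding antichains_def by blast
    then show "A \<in> \<V>" using B C by auto
  qed
  from this[OF S T eq] this[OF T S eq[symmetric]] show ?thesis by blast
qed

lemma ex_strategy_asking_all:
  assumes "\<And>\<S> \<T>. \<S> \<in> C \<Longrightarrow> \<T> \<in> C \<Longrightarrow> (\<And>Q. Q \<in> set Qs \<Longrightarrow> answer \<S> Q = answer \<T> Q) \<Longrightarrow> \<S> = \<T>"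
    and "\<And>Q. Q \<in> set Qs \<Longrightarrow> Q \<subseteq> {1..n}"
  shows "\<exists>t. valid_strategy n t \<and> (\<forall>\<S>\<in>C. announced \<S> t = \<S> \<and> queries_used \<S> t \<le> length Qs)"
  using assms
proof (induction Qs arbitrary: C)
  case Nil
  have "\<exists>\<F>. \<forall>\<S>\<in>C. \<S> = \<F>"
    using Nil.prems(1) by (metis empty_iff list.set(1))
  then obtain \<F> where "\<forall>\<S>\<in>C. \<S> = \<F>" ..
  then show ?case by (intro exI[of _ "Announce \<F>"]) auto
next
  case (Cons Q Qs)
  have "\<exists>t. valid_strategy n t \<and>
      (\<forall>\<S>\<in>{\<S>\<in>C. answer \<S> Q = b}. announced \<S> t = \<S> \<and> queries_used \<S> t \<le> length Qs)" for b
  proof (rule Cons.IH)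
    fix \<S> \<T> assume "\<S> \<in> {\<S>\<in>C. answer \<S> Q = b}" "\<T> \<in> {\<S>\<in>C. answer \<S> Q = b}"
      "\<And>Q. Q \<in> set Qs \<Longrightarrow> answer \<S> Q = answer \<T> Q"
    then show "\<S> = \<T>" by (intro Cons.prems(1)) auto
  qed (use Cons.prems(2) in auto)
  from this[of True] this[of False] obtain t u where
    "valid_strategy n t" "\<forall>\<S>\<in>C. answer \<S> Q \<longrightarrow> announced \<S> t = \<S> \<and> queries_used \<S> t \<le> length Qs"
    "valid_strategy n u" "\<forall>\<S>\<in>C. \<not> answer \<S> Q \<longrightarrow> announced \<S> u = \<S> \<and> queries_used \<S> u \<le> length Qs"
    by auto
  then show ?case using Cons.prems(2) by (intro exI[of _ "Ask Q t u"]) auto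
qed

lemma ex_identifies_within: "\<exists>q t. identifies_within n k q t"
proof -
  obtain Qs where Qs: "set Qs = Pow {1..n}"
    using finite_list[of "Pow {1..n}"] by auto
  have "\<exists>t. valid_strategy n t \<and>
      (\<forall>\<S>\<in>antichains n k. announced \<S> t = \<S> \<and> queries_used \<S> t \<le> length Qs)"
  proof (rule ex_strategy_asking_all)
    fix \<S> \<T> assume "\<S> \<in> antichains n k" "\<T> \<in> antichains n k"
      "\<And>Q. Q \<in> set Qs \<Longrightarrow> answer \<S> Q = answer \<T> Q"
    then show "\<S> = \<T>" unfolding Qs by (intro antichain_eq_if_same_answers) auto
  qed (use Qs in auto)
  then show ?thesis unfolding identifies_within_def by blast
qed

end

theory Submission
  imports Defs "HOL-Analysis.Convex" "HOL-Library.FuncSet"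
begin

text \<open>
  Put \<open>j = k - 1\<close>.

  Lower bound: take \<open>j\<close> disjoint sets of size \<open>m = n div j\<close> and, as the last member, the complement
  (in their union) of a transversal. A query that contains none of the \<open>j\<close> sets misses some
  transversal, hence receives the answer YES for at most one of the \<open>m ^ j\<close> candidates, so each
  query rules out at most one of them.

  Upper bound: members are found one at a time. If the members in \<open>\<A>\<close> are known, then an unknown
  member avoids some minimal transversal of \<open>\<A>\<close>. Querying the complements of the minimal
  transversals therefore yields a YES, and shrinking that query element by element reaches a new
  member. Minimal transversals have at most \<open>card \<A>\<close> elements, so only those with exactly \<open>j\<close>
  elements, in the last round, matter. Each of their elements lies in exactly one member
  of \<open>\<A>\<close>, so their number is at most a product of the sizes of \<open>j\<close> disjoint sets, to which AM-GM
  applies.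
\<close>

section \<open>Lower bound\<close>

text \<open>Induction on the tree. A query answered YES by all of \<open>D\<close> leaves
  \<open>D\<close> whole. Any other query has at most one YES in \<open>D\<close>, so its NO branch
  keeps all but one candidate. A leaf tells apart at most one family, whence the \<open>Suc\<close>.
  The assumption on queries passes to subsets of \<open>D\<close>, so the induction can follow the
  NO branch.\<close>

lemma card_le_Suc_queries:
  assumes "valid_strategy n t"
    and "\<And>\<S>. \<S> \<in> D \<Longrightarrow> announced \<S> t = \<S> \<and> queries_used \<S> t \<le> q"
    and "\<And>Q. Q \<subseteq> {1..n} \<Longrightarrow> (\<forall>\<S>\<in>D. answer \<S> Q) \<or>
            (\<forall>\<S>\<in>D. \<forall>\<T>\<in>D. answer \<S> Q \<longrightarrow> answer \<T> Q \<longrightarrow> \<S> = \<T>)"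
    and "finite D"
  shows "card D \<le> Suc q"
  using assms
proof (induction t arbitrary: D q)
  case (Announce \<F>)
  then have "D \<subseteq> {\<F>}" by auto
  then have "card D \<le> card {\<F>}" by (intro card_mono) auto
  then show ?case by simp
next
  case (Ask Q t u)
  show ?case
  proof (cases "D = {}")
    case False
    \<comment> \<open>Some candidate passes through this node, so the budget is positive.\<close>
    then obtain q' where q: "q = Suc q'"
      using Ask.prems(2) by (cases q) fastforce+
    show ?thesis
    proof (cases "\<forall>\<S>\<in>D. answer \<S> Q")
      case True
      have "card D \<le> Suc q'"
      proof (rule Ask.IH(1))
        show "announced \<S> t = \<S> \<and> queries_used \<S> t \<le> q'" if "\<S> \<in> D" for \<S>
          using Ask.prems(2)[OF that] True that q by auto
      qed (use Ask.prems in auto)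
      then show ?thesis using q by simp
    next
      case no: False
      define E where "E = {\<S>\<in>D. \<not> answer \<S> Q}"
      have one: "\<S> = \<T>" if "\<S> \<in> D - E" "\<T> \<in> D - E" for \<S> \<T>
        using Ask.prems(3)[of Q] Ask.prems(1) no that unfolding E_def by auto
      have "card (D - E) \<le> Suc 0"
        using one Ask.prems(4) by (intro card_le_Suc0_iff_eq[THEN iffD2]) auto
      moreover have "card E \<le> Suc q'"
      proof (rule Ask.IH(2))
        show "announced \<S> u = \<S> \<and> queries_used \<S> u \<le> q'" if "\<S> \<in> E" for \<S>
          using Ask.prems(2)[of \<S>] that q by (auto simp: E_def)
        show "(\<forall>\<S>\<in>E. answer \<S> Q') \<or>
            (\<forall>\<S>\<in>E. \<forall>\<T>\<in>E. answer \<S> Q' \<longrightarrow> answer \<T> Q' \<longrightarrow> \<S> = \<T>)" if "Q' \<subseteq> {1..n}" for Q'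
          using Ask.prems(3)[OF that] by (auto simp: E_def)
      qed (use Ask.prems in \<open>auto simp: E_def\<close>)
      moreover have "card D = card (D - E) + card E"
        using Ask.prems(4) by (subst card_Un_disjoint[symmetric]) (auto simp: E_def intro: arg_cong[where f = card])
      ultimately show ?thesis using q by simp
    qed
  qed simp
qed

text \<open>\<open>e\<close> places a \<open>j\<close> by \<open>m\<close> grid in the ground set.
  \<open>P i\<close> is row \<open>i\<close>, and \<open>B f\<close> is the grid with the entry in
  column \<open>f i\<close> deleted from each row \<open>i\<close>. The \<open>m ^ j\<close>
  extensional functions \<open>f\<close> index the candidates \<open>F f\<close>.\<close>

lemma power_le_Suc_queries:
  assumes id: "identifies_within n (Suc j) q t" and j: "j \<ge> 2" and m: "m \<ge> 2" and jm: "j * m \<le> n"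
  shows "m ^ j \<le> Suc q"
proof -
  have "card ({..<j} \<times> {..<m}) \<le> card {1..n}" using jm by simp
  then obtain e where e: "e ` ({..<j} \<times> {..<m}) \<subseteq> {1..n}" and inj: "inj_on e ({..<j} \<times> {..<m})"
    using card_le_inj[of "{..<j} \<times> {..<m}" "{1..n}"] by auto
  have e_eq: "e (i, a) = e (i', a') \<longleftrightarrow> i = i' \<and> a = a'"
    if "i < j" "a < m" "i' < j" "a' < m" for i a i' a'
    using inj_on_eq_iff[OF inj, of "(i, a)" "(i', a')"] that by simp
  define P where "P i = (\<lambda>a. e (i, a)) ` {..<m}" for i
  define B where "B f = {e (i, a) |i a. i < j \<and> a < m \<and> a \<noteq> f i}" for f :: "nat \<Rightarrow> nat"
  define F where "F f = insert (B f) (P ` {..<j})" for f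
  define X where "X = {..<j} \<rightarrow>\<^sub>E {..<m}"
  have X: "f i < m" if "f \<in> X" "i < j" for f i
    using that by (auto simp: X_def PiE_iff)
  have P_sub_P: "i = i'" if "P i \<subseteq> P i'" "i < j" "i' < j" for i i'
  proof -
    have "e (i, 0) \<in> P i'" using that(1) m by (auto simp: P_def)
    then show ?thesis using e_eq that m by (auto simp: P_def)
  qed
  have P_sub_B: "\<not> P i \<subseteq> B f" if "f \<in> X" "i < j" for f i
  proof
    assume "P i \<subseteq> B f"
    then have "e (i, f i) \<in> B f" using X[OF that] by (auto simp: P_def)
    then show False using e_eq X that by (auto simp: B_def)
  qed
  have B_sub_P: "\<not> B f \<subseteq> P i" if "f \<in> X" "i < j" for f i
  proof
    assume sub: "B f \<subseteq> P i"
    \<comment> \<open>Since \<open>j\<close> and \<open>m\<close> are at least 2, there is a second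
      row \<open>i'\<close> and in it a column \<open>a\<close> that \<open>f\<close> does not
      delete. The entry there lies in \<open>B f\<close> but not in row \<open>i\<close>.\<close>
    define i' :: nat where "i' = (if i = 0 then 1 else 0)"
    define a :: nat where "a = (if f i' = 0 then 1 else 0)"
    have ia: "i' < j" "i' \<noteq> i" "a < m" "a \<noteq> f i'" using j m by (auto simp: i'_def a_def)
    then have "e (i', a) \<in> B f" by (auto simp: B_def)
    then have "e (i', a) \<in> P i" using sub by blast
    then show False using ia that e_eq by (auto simp: P_def)
  qed
  have B_sub_B: "f = g" if "B f \<subseteq> B g" "f \<in> X" "g \<in> X" for f g
  proof -
    have "f i = g i" if "i < j" for i
    proof (rule ccontr)
      assume ne: "f i \<noteq> g i"
      then have "e (i, g i) \<in> B f" using X[OF \<open>g \<in> X\<close> that] that unfolding B_def by (metis (mono_tags, lifting) mem_Collect_eq)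
      then have "e (i, g i) \<in> B g" using \<open>B f \<subseteq> B g\<close> by blast
      then show False using e_eq that X[OF \<open>g \<in> X\<close> that] by (auto simp: B_def)
    qed
    then show ?thesis
      using that(2,3) unfolding X_def by (intro PiE_ext) auto
  qed
  have F_antichain: "F f \<in> antichains n (Suc j)" if "f \<in> X" for f
  proof -
    have "B f \<notin> P ` {..<j}" using P_sub_B[OF that] by auto
    moreover have "inj_on P {..<j}" using P_sub_P by (auto simp: inj_on_def)
    ultimately have "card (F f) = Suc j" by (simp add: F_def card_image)
    moreover have "F f \<subseteq> Pow {1..n}" using e by (auto simp: F_def P_def B_def)
    ultimately show ?thesis
      using P_sub_B[OF that] B_sub_P[OF that] P_sub_P by (auto simp: antichains_def F_def)
  qed
  have "inj_on F X"
  proof (rule inj_onI)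
    fix f g assume fg: "f \<in> X" "g \<in> X" "F f = F g"
    then have "B f \<in> F g" by (auto simp: F_def)
    then have "B f = B g" using B_sub_P[OF fg(1)] by (auto simp: F_def)
    then show "f = g" using B_sub_B fg by simp
  qed
  then have "card (F ` X) = card X" by (rule card_image)
  also have "\<dots> = m ^ j" by (simp add: X_def card_PiE)
  finally have card: "card (F ` X) = m ^ j" .
  have "card (F ` X) \<le> Suc q"
  proof (rule card_le_Suc_queries)
    show "valid_strategy n t" using id by (simp add: identifies_within_def)
    show "finite (F ` X)" by (simp add: X_def finite_PiE)
    show "announced \<S> t = \<S> \<and> queries_used \<S> t \<le> q" if "\<S> \<in> F ` X" for \<S>
      using id F_antichain that by (auto simp: identifies_within_def)
    fix Q :: "nat set"
    show "(\<forall>\<S>\<in>F ` X. answer \<S> Q) \<or>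
        (\<forall>\<S>\<in>F ` X. \<forall>\<T>\<in>F ` X. answer \<S> Q \<longrightarrow> answer \<T> Q \<longrightarrow> \<S> = \<T>)"
    proof (cases "\<exists>i<j. P i \<subseteq> Q")
      case True
      then show ?thesis by (auto simp: answer_def F_def)
    next
      case False
      \<comment> \<open>If \<open>Q\<close> contains no row, it misses an entry \<open>h i\<close>
        of every row \<open>i\<close>. A set \<open>B f\<close> inside \<open>Q\<close> must omit
        all of these, but it omits only one entry per row, so \<open>f\<close> agrees with
        \<open>h\<close>.\<close>
      then have "\<forall>i. \<exists>a. i < j \<longrightarrow> a < m \<and> e (i, a) \<notin> Q" by (auto simp: P_def image_subset_iff)
      then obtain h where h: "\<And>i. i < j \<Longrightarrow> h i < m \<and> e (i, h i) \<notin> Q" by metis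
      have "f = restrict h {..<j}" if "f \<in> X" "answer (F f) Q" for f
      proof -
        have sub: "B f \<subseteq> Q" using that(2) False by (auto simp: answer_def F_def)
        have "f i = h i" if "i < j" for i
        proof (rule ccontr)
          assume "f i \<noteq> h i"
          then have "e (i, h i) \<in> B f" using h[OF that] that unfolding B_def by (metis (mono_tags, lifting) mem_Collect_eq)
          then show False using sub h[OF that] by blast
        qed
        then show ?thesis using that(1) by (auto simp: X_def fun_eq_iff PiE_def extensional_def)
      qed
      then show ?thesis by blast
    qed
  qed
  then show ?thesis using card by simp
qed

section \<open>Upper bound\<close>

text \<open>The class \<open>C\<close> is arbitrary, so that it can be the set of candidates
  consistent with the answers received so far.\<close>

definition identifiable :: "nat \<Rightarrow> nat set set set \<Rightarrow> nat \<Rightarrow> bool" where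
  "identifiable n C q \<longleftrightarrow>
    (\<exists>t. valid_strategy n t \<and> (\<forall>\<S>\<in>C. announced \<S> t = \<S> \<and> queries_used \<S> t \<le> q))"

lemma identifiable_mono:
  "identifiable n C q \<Longrightarrow> D \<subseteq> C \<Longrightarrow> q \<le> r \<Longrightarrow> identifiable n D r"
  unfolding identifiable_def by (meson le_trans subsetD)

lemma identifiable_subset_singleton: "C \<subseteq> {\<F>} \<Longrightarrow> identifiable n C q"
  unfolding identifiable_def by (intro exI[of _ "Announce \<F>"]) auto

lemma identifiable_ask:
  assumes "Q \<subseteq> {1..n}" "identifiable n {\<S>\<in>C. answer \<S> Q} q" "identifiable n {\<S>\<in>C. \<not> answer \<S> Q} q"
  shows "identifiable n C (Suc q)"
proof -
  obtain t u where "valid_strategy n t" "valid_strategy n u"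
    "\<forall>\<S>\<in>C. answer \<S> Q \<longrightarrow> announced \<S> t = \<S> \<and> queries_used \<S> t \<le> q"
    "\<forall>\<S>\<in>C. \<not> answer \<S> Q \<longrightarrow> announced \<S> u = \<S> \<and> queries_used \<S> u \<le> q"
    using assms(2,3) unfolding identifiable_def by auto
  then show ?thesis
    using assms(1) unfolding identifiable_def by (intro exI[of _ "Ask Q t u"]) auto
qed

text \<open>The members of \<Q> are asked in turn up to the first YES, after which the strategy for
  that query takes over. Earlier NO answers only shrink the class, so that strategy still applies.
  When \<Q> is exhausted, no candidate is left.\<close>

lemma identifiable_ask_until_yes:
  assumes "finite \<Q>" "\<And>Q. Q \<in> \<Q> \<Longrightarrow> Q \<subseteq> {1..n}"
    and "\<And>\<S>. \<S> \<in> C \<Longrightarrow> \<exists>Q\<in>\<Q>. answer \<S> Q"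
    and "\<And>Q. Q \<in> \<Q> \<Longrightarrow> identifiable n {\<S>\<in>C. answer \<S> Q} q"
  shows "identifiable n C (card \<Q> + q)"
  using assms
proof (induction \<Q> arbitrary: C rule: finite_induct)
  case empty
  then have "C = {}" by auto
  then show ?case using identifiable_subset_singleton by blast
next
  case (insert Q \<Q>)
  have "identifiable n {\<S>\<in>C. \<not> answer \<S> Q} (card \<Q> + q)"
  proof (rule insert.IH)
    show "identifiable n {\<S> \<in> {\<S>\<in>C. \<not> answer \<S> Q}. answer \<S> Q'} q" if "Q' \<in> \<Q>" for Q'
      by (rule identifiable_mono[OF insert.prems(3)[of Q']]) (use that in auto)
  qed (use insert.prems in auto)
  moreover have "identifiable n {\<S>\<in>C. answer \<S> Q} (card \<Q> + q)"
    by (rule identifiable_mono[OF insert.prems(3)[of Q]]) auto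
  ultimately show ?case
    using identifiable_ask[of Q n C] insert by simp
qed

lemma answer_mono: "answer \<S> Q \<Longrightarrow> Q \<subseteq> R \<Longrightarrow> answer \<S> R"
  unfolding answer_def by blast

text \<open>A member inside \<open>Q\<close> that missed some \<open>x\<close> of \<open>Q\<close>
  would also lie in \<open>Q - {x}\<close>.\<close>

lemma mem_if_minimal_answer:
  assumes "answer \<S> Q" "\<And>x. x \<in> Q \<Longrightarrow> \<not> answer \<S> (Q - {x})"
  shows "Q \<in> \<S>"
proof -
  obtain A where A: "A \<in> \<S>" "A \<subseteq> Q" using assms(1) by (auto simp: answer_def)
  have "x \<in> A" if "x \<in> Q" for x
    using assms(2)[OF that] A by (auto simp: answer_def)
  then show ?thesis using A by (metis subsetI subset_antisym)
qed

text \<open>\<open>X\<close> holds the elements of \<open>Q\<close> not yet tested; deleting any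
  other element of \<open>Q\<close> is known to turn the answer into NO. Testing \<open>x\<close>
  costs one query: on YES it is dropped from \<open>Q\<close>, on NO it stays for good. Once
  \<open>X\<close> is empty, \<open>Q\<close> itself is a member.\<close>

lemma identifiable_shrink:
  assumes "finite X" "X \<subseteq> Q" "Q \<subseteq> {1..n}"
    and "\<And>\<S>. \<S> \<in> C \<Longrightarrow> answer \<S> Q"
    and "\<And>\<S> x. \<S> \<in> C \<Longrightarrow> x \<in> Q - X \<Longrightarrow> \<not> answer \<S> (Q - {x})"
    and "\<And>A. A \<subseteq> Q \<Longrightarrow> identifiable n {\<S>\<in>C. A \<in> \<S>} q"
  shows "identifiable n C (card X + q)"
  using assms
proof (induction X arbitrary: Q C rule: finite_induct)
  case empty
  have "{\<S>\<in>C. Q \<in> \<S>} = C" using mem_if_minimal_answer empty.prems(3,4) by auto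
  then show ?case using empty.prems(5)[of Q] by simp
next
  case (insert x X)
  have sub: "identifiable n {\<S> \<in> {\<S>\<in>C. R \<S>}. A \<in> \<S>} q" if "A \<subseteq> Q" for A R
    by (rule identifiable_mono[OF insert.prems(5)[OF that]]) auto
  have "identifiable n {\<S>\<in>C. answer \<S> (Q - {x})} (card X + q)"
  proof (rule insert.IH)
    \<comment> \<open>An element indispensable in \<open>Q\<close> stays so in the smaller set, by
      monotonicity of answers.\<close>
    show "\<not> answer \<S> (Q - {x} - {y})"
      if "\<S> \<in> {\<S>\<in>C. answer \<S> (Q - {x})}" "y \<in> Q - {x} - X" for \<S> y
      using insert.prems(4)[of \<S> y] answer_mono[of \<S> "Q - {x} - {y}" "Q - {y}"] that by auto
    show "identifiable n {\<S> \<in> {\<S>\<in>C. answer \<S> (Q - {x})}. A \<in> \<S>} q" if "A \<subseteq> Q - {x}" for A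
      by (rule sub) (use that in auto)
  qed (use insert.prems(1-3) insert.hyps in auto)
  moreover have "identifiable n {\<S>\<in>C. \<not> answer \<S> (Q - {x})} (card X + q)"
  proof (rule insert.IH)
    show "\<not> answer \<S> (Q - {y})"
      if "\<S> \<in> {\<S>\<in>C. \<not> answer \<S> (Q - {x})}" "y \<in> Q - X" for \<S> y
      using insert.prems(4)[of \<S> y] that by (cases "y = x") auto
    show "identifiable n {\<S> \<in> {\<S>\<in>C. \<not> answer \<S> (Q - {x})}. A \<in> \<S>} q" if "A \<subseteq> Q" for A
      by (rule sub) fact
  qed (use insert.prems(1-3) in auto)
  ultimately show ?case
    using identifiable_ask[of "Q - {x}" n C "card X + q"] insert by auto
qed

section \<open>Minimal transversals and their number\<close>

text \<open>Minimality is encoded by private members: each \<open>x\<close> in \<open>T\<close> is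
  the only point of \<open>T\<close> in some member. For empty \<A> the only minimal transversal is
  the empty set, which covers the first round of the search.\<close>

definition min_transversals :: "nat \<Rightarrow> nat set set \<Rightarrow> nat set set" where
  "min_transversals n \<A> =
    {T. T \<subseteq> {1..n} \<and> (\<forall>A\<in>\<A>. A \<inter> T \<noteq> {}) \<and> (\<forall>x\<in>T. \<exists>A\<in>\<A>. A \<inter> T = {x})}"

lemma finite_min_transversals: "finite (min_transversals n \<A>)"
  by (rule finite_subset[of _ "Pow {1..n}"]) (auto simp: min_transversals_def)

text \<open>Take an inclusion-minimal subset of \<open>U\<close> that meets all members. Deleting
  \<open>x\<close> from it loses some member, which therefore met it in \<open>x\<close>
  alone.\<close>

lemma ex_min_transversal_subset:
  assumes "U \<subseteq> {1..n}" "\<And>A. A \<in> \<A> \<Longrightarrow> A \<inter> U \<noteq> {}"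
  shows "\<exists>T\<in>min_transversals n \<A>. T \<subseteq> U"
proof -
  let ?H = "{T. T \<subseteq> U \<and> (\<forall>A\<in>\<A>. A \<inter> T \<noteq> {})}"
  have "finite U" using assms(1) by (rule finite_subset) simp
  then have "finite ?H" by (intro finite_subset[of ?H "Pow U"]) auto
  moreover have "U \<in> ?H" using assms(2) by auto
  ultimately have "\<exists>T\<in>?H. \<forall>T'\<in>?H. T' \<subseteq> T \<longrightarrow> T = T'"
    by (intro finite_has_minimal) auto
  then obtain T where T: "T \<in> ?H" and minimal: "\<forall>T'\<in>?H. T' \<subseteq> T \<longrightarrow> T = T'" ..
  have "\<exists>A\<in>\<A>. A \<inter> T = {x}" if x: "x \<in> T" for x
  proof -
    have "T - {x} \<notin> ?H" using bspec[OF minimal, of "T - {x}"] x by blast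
    then obtain A where "A \<in> \<A>" "A \<inter> (T - {x}) = {}" using T by blast
    moreover have "A \<inter> T \<noteq> {}" using T \<open>A \<in> \<A>\<close> by auto
    ultimately show ?thesis by blast
  qed
  then have "T \<in> min_transversals n \<A>"
    using T assms(1) by (auto simp: min_transversals_def)
  then show ?thesis using T by blast
qed

text \<open>\<open>g\<close> picks a private member for each point; it is injective because the
  traces \<open>g x \<inter> T = {x}\<close> differ.\<close>

lemma min_transversal_private:
  assumes "T \<in> min_transversals n \<A>"
  obtains g where "inj_on g T" "g ` T \<subseteq> \<A>" "\<And>x. x \<in> T \<Longrightarrow> g x \<inter> T = {x}"
proof -
  have "\<forall>x\<in>T. \<exists>A. A \<in> \<A> \<and> A \<inter> T = {x}" using assms by (auto simp: min_transversals_def)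
  from bchoice[OF this] obtain g where g: "\<forall>x\<in>T. g x \<in> \<A> \<and> g x \<inter> T = {x}" ..
  then have "inj_on g T" by (metis inj_onI singleton_inject)
  then show ?thesis using that g by blast
qed

lemma card_min_transversal_le:
  assumes "T \<in> min_transversals n \<A>" "finite \<A>"
  shows "card T \<le> card \<A>"
proof -
  obtain g where "inj_on g T" "g ` T \<subseteq> \<A>" using min_transversal_private[OF assms(1)] .
  then show ?thesis using assms(2) by (rule card_inj_on_le)
qed

lemma card_small_subsets_le:
  "card {T. T \<subseteq> {1..n} \<and> card T \<le> j} \<le> (n + 1) ^ j"
proof -
  \<comment> \<open>A subset with at most \<open>j\<close> elements is the set of nonzero entries of a \<open>j\<close>-tuple padded with \<open>0\<close>.\<close>
  let ?h = "\<lambda>f. f ` {..<j} - {0::nat}"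
  have "T \<in> ?h ` ({..<j} \<rightarrow>\<^sub>E {0..n})" if T: "T \<subseteq> {1..n}" "card T \<le> j" for T
  proof -
    have fin: "finite T" using T(1) by (rule finite_subset) simp
    then obtain g where g: "bij_betw g {0..<card T} T" using ex_bij_betw_nat_finite by blast
    define f where "f = restrict (\<lambda>i. if i < card T then g i else 0) {..<j}"
    have "f \<in> {..<j} \<rightarrow>\<^sub>E {0..n}"
      unfolding f_def
    proof (rule restrict_PiE_iff[THEN iffD2], rule ballI)
      show "(if i < card T then g i else 0) \<in> {0..n}" for i
        using bij_betwE[OF g] T(1) by (cases "i < card T") force+
    qed
    moreover have "T = ?h f"
    proof
      show "T \<subseteq> ?h f"
      proof
        fix x assume x: "x \<in> T"
        then obtain i where "i < card T" "x = g i" using bij_betw_imp_surj_on[OF g] by force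
        then have "x = f i" "i < j" using T(2) by (auto simp: f_def)
        then show "x \<in> ?h f" using x T(1) by auto
      qed
      show "?h f \<subseteq> T" using bij_betwE[OF g] by (auto simp: f_def split: if_splits)
    qed
    ultimately show ?thesis by blast
  qed
  then have "{T. T \<subseteq> {1..n} \<and> card T \<le> j} \<subseteq> ?h ` ({..<j} \<rightarrow>\<^sub>E {0..n})" by blast
  then have "card {T. T \<subseteq> {1..n} \<and> card T \<le> j} \<le> card ({..<j} \<rightarrow>\<^sub>E {0..n})"
    by (rule surj_card_le[rotated]) (simp add: finite_PiE)
  then show ?thesis by (simp add: card_PiE)
qed

text \<open>This crude bound suffices in every round but the last.\<close>

lemma card_min_transversals_le:
  assumes "finite \<A>"
  shows "card (min_transversals n \<A>) \<le> (n + 1) ^ card \<A>"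
proof -
  have "card (min_transversals n \<A>) \<le> card {T. T \<subseteq> {1..n} \<and> card T \<le> card \<A>}"
  proof (rule card_mono)
    show "finite {T. T \<subseteq> {1..n} \<and> card T \<le> card \<A>}"
      by (rule finite_subset[of _ "Pow {1..n}"]) auto
  qed (use card_min_transversal_le[OF _ assms] in \<open>auto simp: min_transversals_def\<close>)
  also have "\<dots> \<le> (n + 1) ^ card \<A>" by (rule card_small_subsets_le)
  finally show ?thesis .
qed

lemma prod_le_mean_power:
  fixes x :: "'a \<Rightarrow> real"
  assumes "finite I" "I \<noteq> {}" "\<And>i. i \<in> I \<Longrightarrow> x i \<ge> 0"
  shows "(\<Prod>i\<in>I. x i) \<le> ((\<Sum>i\<in>I. x i) / card I) ^ card I"
proof -
  have pos: "0 < card I" using assms(1,2) by (simp add: card_gt_0_iff)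
  have nn: "(\<Prod>i\<in>I. x i) \<ge> 0" by (rule prod_nonneg) (use assms in auto)
  have "(\<Prod>i\<in>I. x i) = ((\<Prod>i\<in>I. x i) powr (1 / card I)) ^ card I"
    using pos nn by (cases "(\<Prod>i\<in>I. x i) = 0") (auto simp: powr_powr simp flip: powr_realpow)
  also have "\<dots> \<le> (\<Sum>i\<in>I. x i / card I) ^ card I"
    by (rule power_mono[OF arith_geom_mean]) (use assms in auto)
  finally show ?thesis by (simp add: sum_divide_distrib)
qed

text \<open>Here the private-member map \<open>g\<close> is a bijection from \<open>T\<close> onto
  \<A>, so \<open>T\<close> is the image of its inverse, a choice function with values in the
  regions \<open>R A\<close> of points lying in \<open>A\<close> and in no other member. These
  regions are disjoint, so their sizes sum to at most \<open>n\<close>, and AM-GM bounds the number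
  of choices.\<close>

lemma card_full_min_transversals_le:
  assumes fin: "finite \<A>" and ne: "\<A> \<noteq> {}"
  shows "real (card {T \<in> min_transversals n \<A>. card T = card \<A>}) \<le> (real n / card \<A>) ^ card \<A>"
proof -
  define R where "R A = {x\<in>{1..n}. x \<in> A \<and> (\<forall>A'\<in>\<A>. x \<in> A' \<longrightarrow> A' = A)}" for A
  have finR: "finite (R A)" for A by (simp add: R_def)
  let ?M = "{T \<in> min_transversals n \<A>. card T = card \<A>}"
  have "?M \<subseteq> (\<lambda>f. f ` \<A>) ` (PiE \<A> R)"
  proof
    fix T assume T: "T \<in> ?M"
    then obtain g where g: "inj_on g T" "g ` T \<subseteq> \<A>" "\<And>x. x \<in> T \<Longrightarrow> g x \<inter> T = {x}"
      using min_transversal_private by blast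
    have gT: "g ` T = \<A>" using g T fin by (intro card_subset_eq) (auto simp: card_image)
    define f where "f = restrict (inv_into T g) \<A>"
    have "f ` \<A> = T" using g(1) gT by (auto simp: f_def inv_into_image_cancel simp flip: gT)
    moreover have "f A \<in> R A" if "A \<in> \<A>" for A
    proof -
      obtain x where x: "x \<in> T" "A = g x" using gT \<open>A \<in> \<A>\<close> by blast
      have fA: "f A = x" using x g(1) that by (simp add: f_def)
      \<comment> \<open>\<open>A'\<close> is private to some \<open>y\<close> in \<open>T\<close>,
        and \<open>x\<close> lies in both \<open>A'\<close> and \<open>T\<close>, so
        \<open>x = y\<close>.\<close>
      have "A' = A" if "A' \<in> \<A>" "x \<in> A'" for A'
      proof -
        obtain y where y: "y \<in> T" "A' = g y" using gT \<open>A' \<in> \<A>\<close> by blast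
        then have "x = y" using g(3)[of y] x that by blast
        then show ?thesis using x y by simp
      qed
      moreover have "x \<in> A" using g(3)[of x] x by blast
      ultimately show ?thesis using x T fA by (auto simp: R_def min_transversals_def)
    qed
    moreover have "f \<in> extensional \<A>" by (simp add: f_def)
    ultimately show "T \<in> (\<lambda>f. f ` \<A>) ` (PiE \<A> R)" by (auto simp: PiE_def)
  qed
  then have "card ?M \<le> card (PiE \<A> R)"
    by (rule surj_card_le[rotated]) (simp add: fin finR finite_PiE)
  also have "\<dots> = (\<Prod>A\<in>\<A>. card (R A))" using fin by (rule card_PiE)
  finally have "real (card ?M) \<le> (\<Prod>A\<in>\<A>. real (card (R A)))" by (simp flip: of_nat_prod)
  also have "\<dots> \<le> ((\<Sum>A\<in>\<A>. real (card (R A))) / card \<A>) ^ card \<A>"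
    by (rule prod_le_mean_power) (use assms in auto)
  also have "\<dots> \<le> (real n / card \<A>) ^ card \<A>"
  proof (intro power_mono divide_right_mono)
    have "(\<Sum>A\<in>\<A>. card (R A)) = card (\<Union>A\<in>\<A>. R A)"
      using fin finR by (intro card_UN_disjoint[symmetric]) (auto simp: R_def)
    also have "\<dots> \<le> card {1..n}" by (rule card_mono) (auto simp: R_def)
    finally show "(\<Sum>A\<in>\<A>. real (card (R A))) \<le> real n" by (simp flip: of_nat_sum)
  qed (auto intro!: sum_nonneg divide_nonneg_nonneg)
  finally show ?thesis .
qed

text \<open>Transversals with fewer than \<open>card \<A>\<close> elements contribute only the
  lower-order power. The floor turns the real main term into a number of queries.\<close>

lemma card_min_transversals_le_floor:
  assumes fin: "finite \<A>" and ne: "\<A> \<noteq> {}"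
  shows "card (min_transversals n \<A>) \<le>
    (n + 1) ^ (card \<A> - 1) + nat \<lfloor>(real n / card \<A>) ^ card \<A>\<rfloor>"
proof -
  let ?M = "{T \<in> min_transversals n \<A>. card T = card \<A>}"
  let ?L = "{T. T \<subseteq> {1..n} \<and> card T \<le> card \<A> - 1}"
  have "min_transversals n \<A> \<subseteq> ?L \<union> ?M"
  proof
    fix T assume T: "T \<in> min_transversals n \<A>"
    then have "card T \<le> card \<A> - 1 \<or> card T = card \<A>"
      using card_min_transversal_le[OF T fin] by linarith
    then show "T \<in> ?L \<union> ?M" using T by (auto simp: min_transversals_def)
  qed
  moreover have "finite ?L" by (rule finite_subset[of _ "Pow {1..n}"]) auto
  ultimately have "card (min_transversals n \<A>) \<le> card (?L \<union> ?M)"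
    using finite_min_transversals by (intro card_mono) auto
  also have "\<dots> \<le> card ?L + card ?M" by (rule card_Un_le)
  also have "card ?L \<le> (n + 1) ^ (card \<A> - 1)" by (rule card_small_subsets_le)
  also have "card ?M \<le> nat \<lfloor>(real n / card \<A>) ^ card \<A>\<rfloor>"
    using card_full_min_transversals_le[OF assms] by (rule le_nat_floor)
  finally show ?thesis by simp
qed

section \<open>Finding the members one by one\<close>

text \<open>The budget has three shares: \<open>b\<close> for reaching a YES among complements of
  minimal transversals, \<open>n\<close> for shrinking that query to a member, and \<open>q\<close>
  for the remaining members.\<close>

lemma identifiable_next_member:
  assumes card: "card \<A> < k" and sub: "\<A> \<subseteq> Pow {1..n}" and fin: "finite \<A>"
    and bound: "card (min_transversals n \<A>) \<le> b"
    and rest: "\<And>A. A \<subseteq> {1..n} \<Longrightarrow> A \<notin> \<A> \<Longrightarrow> identifiable n {\<S>\<in>antichains n k. insert A \<A> \<subseteq> \<S>} q"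
  shows "identifiable n {\<S>\<in>antichains n k. \<A> \<subseteq> \<S>} (b + n + q)"
proof -
  let ?C = "{\<S>\<in>antichains n k. \<A> \<subseteq> \<S>}"
  let ?Q = "(\<lambda>T. {1..n} - T) ` min_transversals n \<A>"
  have "identifiable n ?C (card ?Q + (n + q))"
  proof (rule identifiable_ask_until_yes)
    show "finite ?Q" using finite_min_transversals by blast
    show "\<exists>Q\<in>?Q. answer \<S> Q" if "\<S> \<in> ?C" for \<S>
    proof -
      have S: "\<S> \<subseteq> Pow {1..n}" "card \<S> = k" "\<A> \<subseteq> \<S>"
        and anti: "\<And>A B. A \<in> \<S> \<Longrightarrow> B \<in> \<S> \<Longrightarrow> A \<noteq> B \<Longrightarrow> \<not> A \<subseteq> B"
        using that by (auto simp: antichains_def)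
      have "\<S> \<noteq> \<A>" using S(2) card by auto
      then obtain B where B: "B \<in> \<S>" "B \<notin> \<A>" using S(3) by blast
      \<comment> \<open>By the antichain property no known \<open>A\<close> lies inside the unknown
        member \<open>B\<close>, so the complement of \<open>B\<close> is a transversal. A minimal
        one \<open>T\<close> inside it leaves \<open>B\<close> in the complement of
        \<open>T\<close>.\<close>
      have "A \<inter> ({1..n} - B) \<noteq> {}" if "A \<in> \<A>" for A
        using anti[of A B] B S(3) sub that by blast
      then obtain T where "T \<in> min_transversals n \<A>" "T \<subseteq> {1..n} - B"
        using ex_min_transversal_subset[of "{1..n} - B" n \<A>] by blast
      moreover have "B \<subseteq> {1..n} - T" using calculation(2) B(1) S(1) by blast
      ultimately show ?thesis using B(1) by (auto simp: answer_def)
    qed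
    show "identifiable n {\<S>\<in>?C. answer \<S> Q} (n + q)" if Q: "Q \<in> ?Q" for Q
    proof -
      have fQ: "finite Q" and Qn: "Q \<subseteq> {1..n}" using Q by auto
      have "identifiable n {\<S>\<in>?C. answer \<S> Q} (card Q + q)"
      proof (rule identifiable_shrink[where Q = Q])
        show "identifiable n {\<S> \<in> {\<S>\<in>?C. answer \<S> Q}. A \<in> \<S>} q" if A: "A \<subseteq> Q" for A
        proof -
          \<comment> \<open>\<open>Q\<close> is the complement of a transversal, so no known member
            fits into it and the member reached is new.\<close>
          have "A \<notin> \<A>" using A Q by (auto simp: min_transversals_def)
          then show ?thesis
            by (intro identifiable_mono[OF rest[of A]]) (use A Qn in auto)
        qed
      qed (use fQ Qn in auto)
      moreover have "card Q \<le> n" using card_mono[OF _ Qn] by simp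
      ultimately show ?thesis by (elim identifiable_mono) auto
    qed
  qed auto
  moreover have "card ?Q \<le> b"
    using card_image_le[OF finite_min_transversals] bound le_trans by blast
  ultimately show ?thesis by (elim identifiable_mono) auto
qed

lemma identifiable_complete:
  assumes "card \<A> = k"
  shows "identifiable n {\<S>\<in>antichains n k. \<A> \<subseteq> \<S>} q"
proof (rule identifiable_subset_singleton, rule subsetI)
  fix \<S> assume "\<S> \<in> {\<S>\<in>antichains n k. \<A> \<subseteq> \<S>}"
  then have S: "\<S> \<subseteq> Pow {1..n}" "card \<S> = k" "\<A> \<subseteq> \<S>" by (auto simp: antichains_def)
  have "finite \<S>" by (rule finite_subset[OF S(1)]) simp
  then have "\<A> = \<S>" by (rule card_subset_eq) (use S assms in auto)
  then show "\<S> \<in> {\<A>}" by simp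
qed

text \<open>Induction on the number of missing members. Every round is charged the lower-order cost
  \<open>(n + 1) ^ (k - 2) + n\<close>; the floor term is paid once, in the last round.\<close>

lemma identifiable_from_partial:
  assumes k: "k \<ge> 2" and "card \<A> \<le> k" "\<A> \<subseteq> Pow {1..n}" "finite \<A>"
  shows "identifiable n {\<S>\<in>antichains n k. \<A> \<subseteq> \<S>}
    ((k - card \<A>) * ((n + 1) ^ (k - 2) + n) + nat \<lfloor>(real n / real (k - 1)) ^ (k - 1)\<rfloor>)"
  using assms(2-)
proof (induction "k - card \<A>" arbitrary: \<A>)
  case 0
  then show ?case by (intro identifiable_complete) auto
next
  case (Suc d)
  let ?F = "nat \<lfloor>(real n / real (k - 1)) ^ (k - 1)\<rfloor>" and ?c = "(n + 1) ^ (k - 2) + n"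
  have next_card: "k - card (insert A \<A>) = d" "card (insert A \<A>) \<le> k" if "A \<notin> \<A>" for A
    using that Suc.hyps(2) Suc.prems by auto
  show ?case
  proof (cases "d = 0")
    case True
    \<comment> \<open>Exactly one member is missing: only now can a minimal transversal have
      \<open>k - 1\<close> elements.\<close>
    then have j: "card \<A> = k - 1" using Suc.hyps(2) by simp
    then have "\<A> \<noteq> {}" using k by auto
    then have bound: "card (min_transversals n \<A>) \<le> (n + 1) ^ (k - 2) + ?F"
      using card_min_transversals_le_floor[OF Suc.prems(3), of n] k
      by (simp add: j numeral_2_eq_2)
    have "identifiable n {\<S>\<in>antichains n k. \<A> \<subseteq> \<S>} ((n + 1) ^ (k - 2) + ?F + n + 0)"
    proof (rule identifiable_next_member[OF _ Suc.prems(2,3) bound])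
      fix A :: "nat set" assume A: "A \<subseteq> {1..n}" "A \<notin> \<A>"
      then show "identifiable n {\<S>\<in>antichains n k. insert A \<A> \<subseteq> \<S>} 0"
        using next_card[OF A(2)] True by (intro identifiable_complete) auto
    qed (use j k in simp)
    then show ?thesis
      by (rule identifiable_mono) (use True in \<open>simp_all flip: Suc.hyps(2)\<close>)
  next
    case False
    \<comment> \<open>At least two members are missing, so \<open>card \<A>\<close> is at most
      \<open>k - 2\<close> and the crude bound is of lower order.\<close>
    have "card (min_transversals n \<A>) \<le> (n + 1) ^ card \<A>"
      by (rule card_min_transversals_le) fact
    also have "\<dots> \<le> (n + 1) ^ (k - 2)"
      by (rule power_increasing) (use False Suc.hyps(2) in auto)
    finally have bound: "card (min_transversals n \<A>) \<le> (n + 1) ^ (k - 2)" .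
    have "identifiable n {\<S>\<in>antichains n k. \<A> \<subseteq> \<S>} ((n + 1) ^ (k - 2) + n + (d * ?c + ?F))"
    proof (rule identifiable_next_member[OF _ Suc.prems(2,3) bound])
      fix A :: "nat set" assume A: "A \<subseteq> {1..n}" "A \<notin> \<A>"
      have "insert A \<A> \<subseteq> Pow {1..n}" "finite (insert A \<A>)" using A Suc.prems by auto
      then show "identifiable n {\<S>\<in>antichains n k. insert A \<A> \<subseteq> \<S>} (d * ?c + ?F)"
        using Suc.hyps(1)[of "insert A \<A>"] next_card[OF A(2)] by simp
    qed (use Suc.hyps(2) in simp)
    then show ?thesis
      by (rule identifiable_mono) (simp_all flip: Suc.hyps(2))
  qed
qed

section \<open>Asymptotics\<close>

lemma query_complexity_le:
  assumes "k \<ge> 2"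
  shows "real (query_complexity n k) \<le>
    real k * (real (n + 1) ^ (k - 2) + real n) + (real n / real (k - 1)) ^ (k - 1)"
proof -
  let ?F = "nat \<lfloor>(real n / real (k - 1)) ^ (k - 1)\<rfloor>"
  have "identifiable n {\<S>\<in>antichains n k. {} \<subseteq> \<S>} (k * ((n + 1) ^ (k - 2) + n) + ?F)"
    using identifiable_from_partial[OF assms, of "{}" n] by simp
  then have "query_complexity n k \<le> k * ((n + 1) ^ (k - 2) + n) + ?F"
    unfolding query_complexity_def identifiable_def identifies_within_def by (auto intro!: Least_le)
  then have "real (query_complexity n k) \<le> real (k * ((n + 1) ^ (k - 2) + n)) + real ?F"
    by (simp only: flip: of_nat_add)
  moreover have "real ?F \<le> (real n / real (k - 1)) ^ (k - 1)"
    by (rule of_nat_floor) simp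
  ultimately show ?thesis by simp linarith
qed

lemma query_complexity_ge:
  assumes "j \<ge> 2" "n div j \<ge> 2"
  shows "real (n div j) ^ j - 1 \<le> real (query_complexity n (Suc j))"
proof -
  have "\<exists>t. identifies_within n (Suc j) (query_complexity n (Suc j)) t"
    unfolding query_complexity_def by (rule LeastI_ex) (rule ex_identifies_within)
  then obtain t where "identifies_within n (Suc j) (query_complexity n (Suc j)) t" ..
  then have "(n div j) ^ j \<le> Suc (query_complexity n (Suc j))"
    by (rule power_le_Suc_queries) (use assms in auto)
  then have "real ((n div j) ^ j) \<le> real (Suc (query_complexity n (Suc j)))" by (rule of_nat_mono)
  then show ?thesis by simp
qed

theorem theorem1p5:
  fixes k :: nat
  assumes "k \<ge> 3"
  shows "(\<lambda>n. real (query_complexity n k)) \<sim>[at_top] (\<lambda>n. (real n / real (k - 1)) ^ (k - 1))"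
proof -
  define j where "j = k - 1"
  have j: "j \<ge> 2" "k = Suc j" "k - 2 = j - 1" using assms by (auto simp: j_def)
  \<comment> \<open>\<open>2 ^ j\<close> comes from two summands of size at most
    \<open>(2 * n) ^ (j - 1)\<close>, and \<open>j ^ j\<close> from dividing by
    \<open>(n / j) ^ j\<close>.\<close>
  define C where "C = real k * 2 ^ j * real j ^ j"
  let ?r = "\<lambda>n. real (query_complexity n k) / (real n / real j) ^ j"
  have up: "?r n \<le> 1 + C / real n" if n: "n \<ge> 1" for n
  proof -
    \<comment> \<open>As \<open>j\<close> is at least 2, the linear cost of shrinking is absorbed
      into the power \<open>j - 1\<close>.\<close>
    have "real n \<le> real n ^ (j - 1)" using n j by (intro self_le_power) auto
    also have "\<dots> \<le> (2 * real n) ^ (j - 1)" by (rule power_mono) auto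
    finally have "real (n + 1) ^ (j - 1) + real n \<le> (2 * real n) ^ (j - 1) + (2 * real n) ^ (j - 1)"
      using n by (intro add_mono power_mono) auto
    also have "\<dots> = 2 ^ j * real n ^ (j - 1)"
      using j by (cases j) (auto simp: power_mult_distrib)
    finally have "real k * (real (n + 1) ^ (j - 1) + real n) \<le> real k * (2 ^ j * real n ^ (j - 1))"
      by (rule mult_left_mono) simp
    also have "\<dots> = C / real n * (real n / real j) ^ j"
      using n j by (cases j) (auto simp: C_def power_divide)
    finally have "real (query_complexity n k) \<le> (1 + C / real n) * (real n / real j) ^ j"
      using query_complexity_le[of k n] j by (simp add: algebra_simps)
    then show ?thesis using n j by (simp add: divide_le_eq)
  qed
  \<comment> \<open>Rounding gives \<open>n div j\<close> at least \<open>n / j - 1\<close>, which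
    yields the first term; the subtracted term is the normalised \<open>1\<close> lost in the
    counting bound. The condition on \<open>n\<close> makes each row have at least two
    entries.\<close>
  have low: "(1 - real j / real n) ^ j - (real j / real n) ^ j \<le> ?r n" if n: "n \<ge> 2 * j" for n
  proof -
    have n0: "n > 0" using n j by simp
    have "n div j \<ge> 2" using div_le_mono[OF n, of j] j by simp
    then have "real (n div j) ^ j - 1 \<le> real (query_complexity n k)"
      using query_complexity_ge[of j n] j by simp
    moreover have "(real n / real j - 1) ^ j \<le> real (n div j) ^ j"
    proof (rule power_mono)
      show "real n / real j - 1 \<le> real (n div j)"
        using floor_divide_of_nat_eq[of n j, where ?'a = real] floor_correct[of "real n / real j"] by linarith
      show "0 \<le> real n / real j - 1" using n j by (simp add: le_divide_eq)
    qed
    ultimately have "((real n / real j - 1) ^ j - 1) / (real n / real j) ^ j \<le> ?r n"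
      by (intro divide_right_mono) auto
    moreover have "((real n / real j - 1) ^ j - 1) / (real n / real j) ^ j
        = (1 - real j / real n) ^ j - (real j / real n) ^ j"
    proof -
      have "(real n / real j - 1) / (real n / real j) = 1 - real j / real n"
        using n0 j by (simp add: field_simps)
      then have "(real n / real j - 1) ^ j / (real n / real j) ^ j = (1 - real j / real n) ^ j"
        by (metis power_divide)
      moreover have "1 / (real n / real j) ^ j = (real j / real n) ^ j"
        by (simp add: power_divide)
      ultimately show ?thesis by (simp add: diff_divide_distrib)
    qed
    ultimately show ?thesis by simp
  qed
  have zero: "(\<lambda>n. c / real n) \<longlonglongrightarrow> 0" for c :: real by (rule lim_const_over_n)
  have "?r \<longlonglongrightarrow> 1"
  proof (rule tendsto_sandwich)
    have "(\<lambda>n. (1 - real j / real n) ^ j - (real j / real n) ^ j) \<longlonglongrightarrow> (1 - 0) ^ j - 0 ^ j"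
      by (intro tendsto_intros zero)
    then show "(\<lambda>n. (1 - real j / real n) ^ j - (real j / real n) ^ j) \<longlonglongrightarrow> 1"
      using j by (simp add: power_0_left)
    have "(\<lambda>n. 1 + C / real n) \<longlonglongrightarrow> 1 + 0" by (intro tendsto_intros zero)
    then show "(\<lambda>n. 1 + C / real n) \<longlonglongrightarrow> 1" by simp
    show "\<forall>\<^sub>F n in sequentially. ?r n \<le> 1 + C / real n"
      using eventually_ge_at_top[of 1] by (rule eventually_mono) (rule up)
    show "\<forall>\<^sub>F n in sequentially. (1 - real j / real n) ^ j - (real j / real n) ^ j \<le> ?r n"
      using eventually_ge_at_top[of "2 * j"] by (rule eventually_mono) (rule low)
  qed
  then show ?thesis unfolding j_def by (rule asymp_equivI')
qed

end
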